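(* Let $n\ge 2$, let $P=(p_1,\dots,p_n)$ and $Q=(q_1,\dots,q_n)$ be elements of $\Gamma_n$, and let $r,R$ be real numbers with $0<r\le \frac{p_i}{q_i}\le R<\infty$ for all $i\in\{1,\dots,n\}$. Then $$\frac{2}{R+1}\,I(P\|Q)\le F(P\|Q)\le \frac{2}{r+1}\,I(P\|Q).$$
   Context: $\Gamma_n=\{P=(p_1,\dots,p_n): p_i>0,\ \sum_{i=1}^n p_i=1\}$ is the set of finite discrete probability distributions with strictly positive entries. $\ln$ is the natural logarithm. The relative Jensen-Shannon divergence is $F(P\|Q)=\sum_{i=1}^n p_i\ln\left(\frac{2p_i}{p_i+q_i}\right)$. The Jensen-Shannon divergence is $I(P\|Q)=\frac12\left[\sum_{i=1}^n p_i\ln\left(\frac{2p_i}{p_i+q_i}\right)+\sum_{i=1}^n q_i\ln\left(\frac{2q_i}{p_i+q_i}\right)\right]$. *)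

theory Defs
  imports "HOL-Analysis.Analysis"
begin

text \<open>Probability distributions on \<open>n\<close> points are vectors in \<open>real ^ 'n\<close>, with
  \<open>n = CARD('n)\<close>; the finite index type plays the role of \<open>{1, \<dots>, n}\<close>.\<close>

definition Gamma_dist :: "(real ^ 'n) set" where
  "Gamma_dist = {P. (\<forall>i. P $ i > 0) \<and> (\<Sum>i\<in>UNIV. P $ i) = 1}"

definition rel_JS_div :: "real ^ 'n \<Rightarrow> real ^ 'n \<Rightarrow> real" where
  "rel_JS_div P Q = (\<Sum>i\<in>UNIV. P $ i * ln (2 * P $ i / (P $ i + Q $ i)))"

definition JS_div :: "real ^ 'n \<Rightarrow> real ^ 'n \<Rightarrow> real" where
  "JS_div P Q = 1 / 2 *
     ((\<Sum>i\<in>UNIV. P $ i * ln (2 * P $ i / (P $ i + Q $ i))) +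
      (\<Sum>i\<in>UNIV. Q $ i * ln (2 * Q $ i / (P $ i + Q $ i))))"

end

(* By homogeneity both divergences are sums of q_i h(p_i/q_i). Subtracting the tangent line
  (x - 1)/2 at x = 1 from the generator of F does not change the sum, since P and Q have equal
  mass, and makes the generator A nonnegative; let J be the generator of I. Since A''/J'' = 2/(x + 1)
  and r \<le> 1 \<le> R, the comparison of (R + 1) A and (r + 1) A with 2 J holds for every single
  ratio x. As A \<ge> 0, it suffices to take R = max x 1 and r = min x 1, so it comes down
  to the signs of (x + 1) A - 2 J and of A - J; both are monotone in x and vanish at x = 1. *)
theory Submission
  imports Defs
begin

definition rel_JS_gen :: "real \<Rightarrow> real" where
  "rel_JS_gen x = x * ln (2 * x / (x + 1)) - (x - 1) / 2"

text \<open>Value and slope at \<open>x = 1\<close> are both 0 here, so the generator takes no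
  linear correction, unlike that of \<open>rel_JS_div\<close>.\<close>

definition JS_gen :: "real \<Rightarrow> real" where
  "JS_gen x = (x * ln (2 * x / (x + 1)) + ln (2 / (x + 1))) / 2"

lemma ln_ge_one_minus_inverse:
  fixes x :: real
  assumes "x > 0"
  shows "1 - 1 / x \<le> ln x"
  using ln_le_minus_one[of "1 / x"] assms by (simp add: ln_div)

text \<open>This is \<open>ln y \<ge> 1 - 1 / y\<close> at \<open>y = 2 * x / (x + 1)\<close>,
  multiplied by \<open>x\<close>. It gives both the sign of \<open>rel_JS_gen\<close> and the sign
  of the derivative in \<open>weighted_gen_diff_mono\<close>.\<close>

lemma rel_JS_log_ge:
  fixes x :: real
  assumes "x > 0"
  shows "(x - 1) / 2 \<le> x * ln (2 * x / (x + 1))"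
proof -
  have "1 - 1 / (2 * x / (x + 1)) \<le> ln (2 * x / (x + 1))"
    using assms by (intro ln_ge_one_minus_inverse) simp
  then have "x * (1 - 1 / (2 * x / (x + 1))) \<le> x * ln (2 * x / (x + 1))"
    using assms by simp
  moreover have "x * (1 - 1 / (2 * x / (x + 1))) = (x - 1) / 2"
    using assms by (simp add: field_simps)
  ultimately show ?thesis by simp
qed

lemma rel_JS_gen_nonneg: "x > 0 \<Longrightarrow> rel_JS_gen x \<ge> 0"
  using rel_JS_log_ge[of x] by (simp add: rel_JS_gen_def)

lemma rel_JS_gen_deriv:
  assumes "x > 0"
  shows "(rel_JS_gen has_real_derivative ln (2 * x / (x + 1)) + 1 / (x + 1) - 1 / 2) (at x)"
  unfolding rel_JS_gen_def using assms
  by (auto intro!: derivative_eq_intros simp: divide_simps) (simp add: algebra_simps)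

text \<open>The rational terms \<open>1 / (x + 1)\<close> from the two logarithms cancel, leaving
  only a logarithm.\<close>

lemma JS_gen_deriv:
  assumes "x > 0"
  shows "(JS_gen has_real_derivative ln (2 * x / (x + 1)) / 2) (at x)"
  unfolding JS_gen_def using assms
  by (auto intro!: derivative_eq_intros simp: divide_simps)

lemma gen_at_1 [simp]: "rel_JS_gen 1 = 0" "JS_gen 1 = 0"
  by (simp_all add: rel_JS_gen_def JS_gen_def)

lemma weighted_gen_diff_mono:
  assumes "0 < a" "a \<le> b"
  shows "(a + 1) * rel_JS_gen a - 2 * JS_gen a \<le> (b + 1) * rel_JS_gen b - 2 * JS_gen b"
proof (rule DERIV_nonneg_imp_nondecreasing[OF assms(2)], intro exI conjI)
  fix x assume "a \<le> x" "x \<le> b"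
  with assms have x: "x > 0" by simp
  show "((\<lambda>x. (x + 1) * rel_JS_gen x - 2 * JS_gen x) has_real_derivative
      2 * x * ln (2 * x / (x + 1)) + 1 - x) (at x)"
  proof -
    \<comment> \<open>Naming the logarithm makes the comparison of the two derivative forms below
      purely algebraic.\<close>
    define L where "L = ln (2 * x / (x + 1))"
    have "((\<lambda>x. (x + 1) * rel_JS_gen x - 2 * JS_gen x) has_real_derivative
        1 * rel_JS_gen x + (L + 1 / (x + 1) - 1 / 2) * (x + 1) - 2 * (L / 2)) (at x)"
      using x unfolding L_def
      by (intro DERIV_diff DERIV_mult DERIV_cmult rel_JS_gen_deriv JS_gen_deriv)
        (auto intro!: derivative_eq_intros)
    moreover have "1 * rel_JS_gen x + (L + 1 / (x + 1) - 1 / 2) * (x + 1) - 2 * (L / 2)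
        = 2 * x * L + 1 - x"
      using x by (simp add: rel_JS_gen_def flip: L_def) (simp add: field_simps)
    ultimately show ?thesis by (simp add: L_def)
  qed
  \<comment> \<open>The derivative is exactly \<open>2 * rel_JS_gen x\<close>.\<close>
  show "0 \<le> 2 * x * ln (2 * x / (x + 1)) + 1 - x"
    using rel_JS_log_ge[OF x] by simp
qed

lemma gen_diff_antimono:
  assumes "0 < a" "a \<le> b"
  shows "rel_JS_gen b - JS_gen b \<le> rel_JS_gen a - JS_gen a"
proof (rule DERIV_nonpos_imp_nonincreasing[OF assms(2)], intro exI conjI)
  fix x assume "a \<le> x" "x \<le> b"
  with assms have x: "x > 0" by simp
  show "((\<lambda>x. rel_JS_gen x - JS_gen x) has_real_derivative
      (ln (2 * x / (x + 1)) + 1 / (x + 1) - 1 / 2) - ln (2 * x / (x + 1)) / 2) (at x)"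
    using x by (intro DERIV_diff rel_JS_gen_deriv JS_gen_deriv)
  \<comment> \<open>With \<open>y = 2 * x / (x + 1)\<close> the derivative equals
    \<open>(ln y - (y - 1)) / 2\<close>.\<close>
  have "ln (2 * x / (x + 1)) \<le> 2 * x / (x + 1) - 1"
    using x by (intro ln_le_minus_one) simp
  also have "\<dots> = 1 - 2 / (x + 1)"
    using x by (simp add: field_simps)
  finally show "(ln (2 * x / (x + 1)) + 1 / (x + 1) - 1 / 2) - ln (2 * x / (x + 1)) / 2 \<le> 0"
    by simp
qed

text \<open>Right of 1, \<open>weighted_gen_diff_mono\<close> gives the factor \<open>x + 1\<close>;
  left of 1, \<open>gen_diff_antimono\<close> gives the factor 2. Both factors are at most
  \<open>R + 1\<close>.\<close>

lemma JS_gen_le: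
  assumes "0 < x" "x \<le> R" "1 \<le> R"
  shows "2 * JS_gen x \<le> (R + 1) * rel_JS_gen x"
proof (cases "1 \<le> x")
  case True
  have "2 * JS_gen x \<le> (x + 1) * rel_JS_gen x"
    using weighted_gen_diff_mono[of 1 x] True by simp
  also have "\<dots> \<le> (R + 1) * rel_JS_gen x"
    using assms rel_JS_gen_nonneg by (intro mult_right_mono) auto
  finally show ?thesis .
next
  case False
  have "2 * JS_gen x \<le> 2 * rel_JS_gen x"
    using gen_diff_antimono[of x 1] False assms by simp
  also have "\<dots> \<le> (R + 1) * rel_JS_gen x"
    using assms rel_JS_gen_nonneg by (intro mult_right_mono) auto
  finally show ?thesis .
qed

text \<open>The mirror image: each monotonicity result now serves the other side of 1, and
  \<open>r + 1\<close> is at most both 2 and \<open>x + 1\<close>.\<close>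

lemma JS_gen_ge:
  assumes "0 < x" "r \<le> x" "r \<le> 1"
  shows "(r + 1) * rel_JS_gen x \<le> 2 * JS_gen x"
proof (cases "1 \<le> x")
  case True
  have "(r + 1) * rel_JS_gen x \<le> 2 * rel_JS_gen x"
    using assms rel_JS_gen_nonneg by (intro mult_right_mono) auto
  also have "\<dots> \<le> 2 * JS_gen x"
    using gen_diff_antimono[of 1 x] True by simp
  finally show ?thesis .
next
  case False
  have "(r + 1) * rel_JS_gen x \<le> (x + 1) * rel_JS_gen x"
    using assms rel_JS_gen_nonneg by (intro mult_right_mono) auto
  also have "\<dots> \<le> 2 * JS_gen x"
    using weighted_gen_diff_mono[of x 1] False assms by simp
  finally show ?thesis .
qed

lemma log_ratio_homogeneous:
  fixes p q :: real
  assumes "p > 0" "q > 0"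
  shows "2 * (p / q) / (p / q + 1) = 2 * p / (p + q)" "2 / (p / q + 1) = 2 * q / (p + q)"
  using assms by (simp_all add: divide_simps)

lemma rel_JS_div_eq_gen:
  assumes "P \<in> Gamma_dist" "Q \<in> Gamma_dist"
  shows "rel_JS_div P Q = (\<Sum>i\<in>UNIV. Q $ i * rel_JS_gen (P $ i / Q $ i))"
proof -
  have pos: "P $ i > 0" "Q $ i > 0" for i
    using assms by (auto simp: Gamma_dist_def)
  have "Q $ i * rel_JS_gen (P $ i / Q $ i)
      = P $ i * ln (2 * P $ i / (P $ i + Q $ i)) - (P $ i - Q $ i) / 2" for i
    using pos[of i] unfolding rel_JS_gen_def log_ratio_homogeneous[OF pos]
    by (simp add: right_diff_distrib diff_divide_distrib)
  \<comment> \<open>The linear corrections add up to half the difference of the total masses, which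
    is 0.\<close>
  then have "(\<Sum>i\<in>UNIV. Q $ i * rel_JS_gen (P $ i / Q $ i))
      = rel_JS_div P Q - ((\<Sum>i\<in>UNIV. P $ i) - (\<Sum>i\<in>UNIV. Q $ i)) / 2"
    by (simp add: rel_JS_div_def sum_subtractf flip: sum_divide_distrib)
  then show ?thesis
    using assms by (simp add: Gamma_dist_def)
qed

lemma JS_div_eq_gen:
  assumes "P \<in> Gamma_dist" "Q \<in> Gamma_dist"
  shows "JS_div P Q = (\<Sum>i\<in>UNIV. Q $ i * JS_gen (P $ i / Q $ i))"
proof -
  have pos: "P $ i > 0" "Q $ i > 0" for i
    using assms by (auto simp: Gamma_dist_def)
  have "Q $ i * JS_gen (P $ i / Q $ i)
      = (P $ i * ln (2 * P $ i / (P $ i + Q $ i)) + Q $ i * ln (2 * Q $ i / (P $ i + Q $ i))) / 2"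
    for i
    using pos[of i] unfolding JS_gen_def log_ratio_homogeneous[OF pos]
    by (simp add: distrib_left)
  then show ?thesis
    by (simp only: JS_div_def sum.distrib flip: sum_divide_distrib)
qed

text \<open>Clearing denominators and summing over \<open>i\<close> compares the total masses, both
  equal to 1.\<close>

lemma Gamma_dist_ratio_bounds:
  fixes P Q :: "real ^ 'n"
  assumes "P \<in> Gamma_dist" "Q \<in> Gamma_dist"
  shows "(\<And>i. r \<le> P $ i / Q $ i) \<Longrightarrow> r \<le> 1" "(\<And>i. P $ i / Q $ i \<le> R) \<Longrightarrow> 1 \<le> R"
proof -
  have pos: "Q $ i > 0" for i
    using assms by (auto simp: Gamma_dist_def)
  have sums: "(\<Sum>i\<in>UNIV. P $ i) = 1" "(\<Sum>i\<in>UNIV. Q $ i) = 1"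
    using assms by (auto simp: Gamma_dist_def)
  show "r \<le> 1" if "\<And>i. r \<le> P $ i / Q $ i"
  proof -
    have "(\<Sum>i\<in>UNIV. r * Q $ i) \<le> (\<Sum>i\<in>UNIV. P $ i)"
      using that pos by (intro sum_mono) (simp add: pos_le_divide_eq)
    then show ?thesis by (simp add: sums flip: sum_distrib_left)
  qed
  show "1 \<le> R" if "\<And>i. P $ i / Q $ i \<le> R"
  proof -
    have "(\<Sum>i\<in>UNIV. P $ i) \<le> (\<Sum>i\<in>UNIV. R * Q $ i)"
      using that pos by (intro sum_mono) (simp add: pos_divide_le_eq)
    then show ?thesis by (simp add: sums flip: sum_distrib_left)
  qed
qed

theorem proposition5p3:
  fixes P Q :: "real ^ 'n" and r R :: real
  assumes "CARD('n) \<ge> 2"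
    and "P \<in> Gamma_dist" and "Q \<in> Gamma_dist"
    and "0 < r"
    and "\<And>i. r \<le> P $ i / Q $ i"
    and "\<And>i. P $ i / Q $ i \<le> R"
  shows "2 / (R + 1) * JS_div P Q \<le> rel_JS_div P Q
    \<and> rel_JS_div P Q \<le> 2 / (r + 1) * JS_div P Q"
proof -
  have Q: "Q $ i > 0" and ratio: "P $ i / Q $ i > 0" for i
    using assms(2,3) by (auto simp: Gamma_dist_def)
  have "r \<le> 1" "1 \<le> R"
    using Gamma_dist_ratio_bounds[OF assms(2,3)] assms(5,6) by auto
  have "(\<Sum>i\<in>UNIV. Q $ i * (2 * JS_gen (P $ i / Q $ i)))
      \<le> (\<Sum>i\<in>UNIV. Q $ i * ((R + 1) * rel_JS_gen (P $ i / Q $ i)))"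
    using Q ratio assms(6) \<open>1 \<le> R\<close>
    by (intro sum_mono mult_left_mono JS_gen_le) (auto intro: less_imp_le)
  then have upper: "2 * JS_div P Q \<le> (R + 1) * rel_JS_div P Q"
    by (simp add: JS_div_eq_gen rel_JS_div_eq_gen assms(2,3) sum_distrib_left mult.left_commute)
  have "(\<Sum>i\<in>UNIV. Q $ i * ((r + 1) * rel_JS_gen (P $ i / Q $ i)))
      \<le> (\<Sum>i\<in>UNIV. Q $ i * (2 * JS_gen (P $ i / Q $ i)))"
    using Q ratio assms(5) \<open>r \<le> 1\<close>
    by (intro sum_mono mult_left_mono JS_gen_ge) (auto intro: less_imp_le)
  then have lower: "(r + 1) * rel_JS_div P Q \<le> 2 * JS_div P Q"
    by (simp add: JS_div_eq_gen rel_JS_div_eq_gen assms(2,3) sum_distrib_left mult.left_commute)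
  \<comment> \<open>Both \<open>R + 1\<close> and \<open>r + 1\<close> are positive, so they can be
    divided out.\<close>
  show ?thesis
    using upper lower \<open>0 < r\<close> \<open>1 \<le> R\<close> by (simp add: field_simps)
qed

end
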